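(* Every simple connected graph $G$ has a spanning tree $T$ such that there is no path of length $2$ in $T$ all of whose (three) vertices have degree $2$ in $T$ and degree at least $3$ in $G$.
   Context: All graphs are finite. A path of length $2$ is a path with two edges (three vertices). *)

theory Defs
  imports "Graph_Theory.Graph_Theory"
begin

text \<open>
  A finite simple graph is a \<^locale>\<open>pair_graph\<close>: a finite vertex set with a symmetric, irreflexive
  arc relation, where an undirected edge is the pair of arcs (u, v), (v, u).

  The library's \<^const>\<open>tree\<close> and \<^const>\<open>spanning_tree\<close> are not the undirected notions. On the one
  hand they count u, v, u as a cycle, so no symmetric graph with an edge is a tree; on the other
  hand they only forbid directed cycles, so a non-symmetric tree may have cycles in its underlying
  graph. Below trees are symmetric themselves, and a cycle has at least three edges.
\<close>

definition undirected_tree :: "'a pair_pre_digraph \<Rightarrow> bool" where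
  "undirected_tree T \<longleftrightarrow> pair_graph T \<and> connected (with_proj T) \<and>
     \<not> (\<exists>p. pre_digraph.cycle (with_proj T) p \<and> length p \<ge> 3)"

definition undirected_spanning_tree :: "'a pair_pre_digraph \<Rightarrow> 'a pair_pre_digraph \<Rightarrow> bool" where
  "undirected_spanning_tree T G \<longleftrightarrow> undirected_tree T \<and> spanning (with_proj T) (with_proj G)"

text \<open>In a symmetric graph each edge at v contributes exactly one arc leaving v.\<close>

definition degree :: "'a pair_pre_digraph \<Rightarrow> 'a \<Rightarrow> nat" where
  "degree G v = out_degree (with_proj G) v"

end

theory Submission
  imports Defs
begin

text \<open>
  Grow the tree from a vertex by expansions: expanding a vertex attaches all its neighbours that are
  still outside. Call a vertex weak if it has degree 2 in the tree and degree at least 3 in G.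
  Between rounds every leaf with outside neighbours hangs from a vertex that is not weak. If some
  leaf has two outside neighbours, expand it. Otherwise let w be the only outside neighbour of a
  leaf x. If w has no further outside neighbour, or at least two, expand x and w. If it has exactly
  one, y, and y is not adjacent to the tree, expand x, w and y: then y has its full degree in the
  tree, so it is not weak and the weak path x, w ends there. If y is adjacent to a leaf l, then
  either y has two outside neighbours and one expands l and y, or w and y are attached to x and l
  and have no outside neighbours left.
\<close>

section \<open>Trees as sequences of leaf attachments\<close>

text \<open>Induction over the attached leaves serves to prove both connectedness and acyclicity.
  Each edge enters as its two opposite arcs because trees here are symmetric.\<close>

inductive tree_on :: "'a set \<Rightarrow> 'a rel \<Rightarrow> bool" where
  single: "tree_on {r} {}"
| leaf: "tree_on U F \<Longrightarrow> v \<in> U \<Longrightarrow> w \<notin> U \<Longrightarrow>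
    tree_on (insert w U) (insert (v, w) (insert (w, v) F))"

definition attach :: "'a \<Rightarrow> 'a set \<Rightarrow> 'a rel \<Rightarrow> 'a rel" where
  "attach v S F = F \<union> {v} \<times> S \<union> S \<times> {v}"

lemma attach_empty [simp]: "attach v {} F = F"
  by (simp add: attach_def)

lemma tree_on_attach:
  assumes "finite S" "tree_on U F" "v \<in> U" "S \<inter> U = {}"
  shows "tree_on (U \<union> S) (attach v S F)"
  using assms
proof (induction S rule: finite_induct)
  case (insert w S)
  then have "tree_on (insert w (U \<union> S)) (insert (v, w) (insert (w, v) (attach v S F)))"
    by (intro leaf) auto
  moreover have "insert (v, w) (insert (w, v) (attach v S F)) = attach v (insert w S) F"
    by (auto simp: attach_def)
  ultimately show ?case by simp
qed simp

lemma tree_on_subset: "tree_on U F \<Longrightarrow> F \<subseteq> U \<times> U"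
  by (induction rule: tree_on.induct) auto

lemma tree_on_finite: "tree_on U F \<Longrightarrow> finite U"
  by (induction rule: tree_on.induct) auto

lemma tree_on_sym: "tree_on U F \<Longrightarrow> sym F"
  by (induction rule: tree_on.induct) (auto simp: sym_def)

lemma tree_on_irrefl: "tree_on U F \<Longrightarrow> (x, x) \<notin> F"
  by (induction rule: tree_on.induct) auto

lemma tree_on_pair_graph:
  assumes "tree_on U F"
  shows "pair_graph \<lparr>pverts = U, parcs = F\<rparr>"
proof -
  have "F \<subseteq> U \<times> U" "finite U" "sym F" "\<And>x. (x, x) \<notin> F"
    using assms by (auto dest: tree_on_subset tree_on_finite tree_on_sym tree_on_irrefl)
  moreover from this have "finite F" by (meson finite_SigmaI finite_subset)
  ultimately show ?thesis
    by unfold_locales (auto simp: symmetric_def)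
qed

section \<open>Connectedness of trees\<close>

lemma rtrancl_on_subset:
  assumes "(a, b) \<in> rtrancl_on A r" "A \<subseteq> B" "r \<subseteq> s"
  shows "(a, b) \<in> rtrancl_on B s"
  using assms by induction (auto intro: converse_rtrancl_on_into_rtrancl_on)

lemma tree_on_reachable:
  assumes "tree_on U F" "x \<in> U" "y \<in> U"
  shows "(x, y) \<in> rtrancl_on U F"
  using assms
proof (induction arbitrary: x y rule: tree_on.induct)
  case (leaf U F v w)
  let ?U = "insert w U" and ?F = "insert (v, w) (insert (w, v) F)"
  have old: "(a, b) \<in> rtrancl_on ?U ?F" if "a \<in> U" "b \<in> U" for a b
    using leaf.IH[OF that] by (rule rtrancl_on_subset) auto
  \<comment> \<open>Every walk is routed through \<open>v\<close>, so one argument covers the cases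
    in which \<open>x\<close>, \<open>y\<close> or both are the new leaf \<open>w\<close>.\<close>
  have to_v: "(a, v) \<in> rtrancl_on ?U ?F" if "a \<in> ?U" for a
  proof (cases "a \<in> U")
    case False
    with that have "a = w" by simp
    then show ?thesis
      using rtrancl_on_into_rtrancl_on[of w w ?U ?F v] leaf.hyps by simp
  qed (use old leaf.hyps in auto)
  have from_v: "(v, b) \<in> rtrancl_on ?U ?F" if "b \<in> ?U" for b
  proof (cases "b \<in> U")
    case False
    with that have "b = w" by simp
    then show ?thesis
      using rtrancl_on_into_rtrancl_on[of v v ?U ?F w] leaf.hyps by simp
  qed (use old leaf.hyps in auto)
  show ?case
    using to_v[OF leaf.prems(1)] from_v[OF leaf.prems(2)] by (rule rtrancl_on_trans)
qed simp

text \<open>\<open>connected\<close> means strong connectedness of the symmetric closure, and a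
  symmetric graph has the same reachability as its closure.\<close>

lemma sym_connected_iff:
  assumes "pair_graph G"
  shows "connected (with_proj G) \<longleftrightarrow> pverts G \<noteq> {} \<and>
    (\<forall>u \<in> pverts G. \<forall>v \<in> pverts G. (u, v) \<in> rtrancl_on (pverts G) (parcs G))"
proof -
  interpret pair_graph G by fact
  have "symmetric (with_proj G)" by (rule sym_arcs)
  then show ?thesis
    using reachable_mk_symmetric_eq
    by (auto simp: connected_def strongly_connected_def reachable_def)
qed

lemma tree_on_connected:
  assumes "tree_on U F"
  shows "connected (with_proj \<lparr>pverts = U, parcs = F\<rparr>)"
proof -
  have "U \<noteq> {}" using assms by cases auto
  then show ?thesis
    using assms by (auto simp: sym_connected_iff tree_on_pair_graph tree_on_reachable)
qed

section \<open>Absence of cycles\<close>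

lemma pcas_nth:
  "pcas u p v \<Longrightarrow> i < length p \<Longrightarrow>
    fst (p ! i) = (if i = 0 then u else snd (p ! (i - 1)))"
proof (induction p arbitrary: u i)
  case (Cons e p)
  then show ?case by (cases i) (auto simp: nth_Cons')
qed simp

lemma pcas_last: "pcas u p v \<Longrightarrow> p \<noteq> [] \<Longrightarrow> snd (last p) = v"
  by (induction p arbitrary: u) (auto split: if_splits)

text \<open>Taking indices modulo the length makes the return from the last arc to the first an
  ordinary step.\<close>

lemma pcas_closed_next:
  assumes "pcas u p u" "p \<noteq> []"
  shows "fst (p ! (Suc i mod length p)) = snd (p ! (i mod length p))"
proof (cases "Suc (i mod length p) = length p")
  case True
  then have "Suc i mod length p = 0" by (simp add: mod_Suc)
  moreover have "i mod length p = length p - 1" using True by simp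
  ultimately show ?thesis
    using assms pcas_nth[of u p u 0] pcas_last[of u p u] by (simp add: last_conv_nth)
next
  case False
  then have "Suc i mod length p = Suc (i mod length p)" by (simp add: mod_Suc)
  moreover have "Suc (i mod length p) < length p"
    using False assms(2) by (metis Suc_lessI length_greater_0_conv mod_less_divisor)
  ultimately show ?thesis
    using assms pcas_nth[of u p u "Suc (i mod length p)"] by simp
qed

text \<open>A cycle that enters a vertex with a single neighbour has to leave it along the same edge.\<close>
lemma closed_walk_avoids_leaf:
  assumes closed: "pcas u p u" and dist: "distinct (map snd p)" and len: "length p \<ge> 3"
    and leaf: "\<And>x. (x, w) \<in> set p \<Longrightarrow> x = v" "\<And>x. (w, x) \<in> set p \<Longrightarrow> x = v"
    and arc: "e \<in> set p"
  shows "fst e \<noteq> w \<and> snd e \<noteq> w"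
proof -
  let ?n = "length p"
  have ne: "p \<noteq> []" using len by auto
  note nxt = pcas_closed_next[OF closed ne]
  have mem: "p ! (k mod ?n) \<in> set p" for k using ne by simp
  have no_head: "snd (p ! (k mod ?n)) \<noteq> w" for k
  proof
    assume h: "snd (p ! (k mod ?n)) = w"
    have "fst (p ! (k mod ?n)) = v"
      using h leaf(1)[of "fst (p ! (k mod ?n))"] mem[of k] by (metis prod.collapse)
    moreover have "(k + ?n) mod ?n = k mod ?n" by simp
    \<comment> \<open>The predecessor of index \<open>k\<close> is written
      \<open>k + ?n - 1\<close>, so that subtraction does not truncate at
      \<open>k = 0\<close>.\<close>
    moreover have "Suc (k + ?n - 1) = k + ?n" using len by simp
    ultimately have before: "snd (p ! ((k + ?n - 1) mod ?n)) = v"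
      using nxt[of "k + ?n - 1"] by simp
    have "fst (p ! (Suc k mod ?n)) = w" using nxt[of k] h by simp
    then have after: "snd (p ! (Suc k mod ?n)) = v"
      using leaf(2)[of "snd (p ! (Suc k mod ?n))"] mem[of "Suc k"] by (metis prod.collapse)
    have lt: "j mod ?n < ?n" for j using ne by simp
    \<comment> \<open>The arcs before and after arc \<open>k\<close> both end in \<open>v\<close>.
      As heads are distinct, the two arcs coincide, so \<open>?n\<close> divides
      \<open>?n - 2\<close>, which is impossible for \<open>?n\<close> at least 3.\<close>
    have "(k + ?n - 1) mod ?n = Suc k mod ?n"
      using dist before after lt
      by (metis (no_types, lifting) length_map nth_eq_iff_index_eq nth_map)
    moreover have "k + ?n - 1 = Suc k + (?n - 2)" using len by simp
    ultimately have "?n dvd ?n - 2"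
      by (metis add_diff_cancel_left' le_add1 mod_eq_dvd_iff_nat)
    then show False using len by (auto dest: dvd_imp_le)
  qed
  obtain i where i: "i < ?n" "e = p ! i" using arc by (metis in_set_conv_nth)
  have "snd e \<noteq> w" using no_head[of i] i by simp
  moreover have "Suc (i + ?n - 1) = i + ?n" using len by simp
  then have "Suc (i + ?n - 1) mod ?n = i" using i by simp
  then have "fst e \<noteq> w"
    using nxt[of "i + ?n - 1"] no_head[of "i + ?n - 1"] i by metis
  ultimately show ?thesis by blast
qed

text \<open>Turns the distinct vertices of a cycle into distinct arc heads, the form in which
  \<open>closed_walk_avoids_leaf\<close> uses them.\<close>

lemma pawalk_verts_pcas: "pcas u p v \<Longrightarrow> pawalk_verts u p = u # map snd p"
  by (induction p arbitrary: u) auto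

text \<open>A cycle misses the leaf attached last, so it already lies in the smaller tree; a single
  vertex has no arcs.\<close>

lemma tree_on_acyclic:
  assumes "tree_on U F" "set p \<subseteq> F" "pcas u p u" "distinct (map snd p)" "length p \<ge> 3"
  shows False
  using assms
proof (induction rule: tree_on.induct)
  case (leaf U F v w)
  have "F \<subseteq> U \<times> U" using leaf.hyps by (blast dest: tree_on_subset)
  then have "fst e \<noteq> w \<and> snd e \<noteq> w" if "e \<in> set p" for e
    using that leaf.prems leaf.hyps
    by (intro closed_walk_avoids_leaf[where p = p and v = v and u = u]) auto
  then have "set p \<subseteq> F" using leaf.prems(1) by fastforce
  then show ?case using leaf.IH leaf.prems by blast
qed auto

lemma tree_on_undirected_tree:
  assumes "tree_on U F"
  shows "undirected_tree \<lparr>pverts = U, parcs = F\<rparr>"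
proof -
  have "\<not> (\<exists>p. pre_digraph.cycle (with_proj \<lparr>pverts = U, parcs = F\<rparr>) p \<and> length p \<ge> 3)"
    using tree_on_acyclic[OF assms]
    by (auto simp: pre_digraph.cycle_def pre_digraph.awalk_def cas_with_proj_eq
        awalk_verts_with_proj_eq pawalk_verts_pcas)
  then show ?thesis
    using assms by (simp add: undirected_tree_def tree_on_pair_graph tree_on_connected)
qed

section \<open>Growing the tree by expansions\<close>

definition outside :: "'a rel \<Rightarrow> 'a set \<Rightarrow> 'a \<Rightarrow> 'a set" where
  "outside E U x = E `` {x} - U"

definition weak :: "'a rel \<Rightarrow> 'a rel \<Rightarrow> 'a \<Rightarrow> bool" where
  "weak E F x \<longleftrightarrow> card (F `` {x}) = 2 \<and> card (E `` {x}) \<ge> 3"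

text \<open>
  X is the set of leaves that may hang from a weak vertex in the middle of a round. The
  conjunct on the outside neighbours of q keeps the expansion of one leaf from making the
  neighbour of another leaf weak.
\<close>
definition growing :: "'a rel \<Rightarrow> 'a set \<Rightarrow> 'a rel \<Rightarrow> 'a set \<Rightarrow> bool" where
  "growing E U F X \<longleftrightarrow> tree_on U F \<and> F \<subseteq> E \<and>
    (\<forall>a b c. (a, b) \<in> F \<longrightarrow> (b, c) \<in> F \<longrightarrow> a \<noteq> c \<longrightarrow>
      \<not> (weak E F a \<and> weak E F b \<and> weak E F c)) \<and>
    (\<forall>v \<in> U. outside E U v \<noteq> {} \<longrightarrow>
      card (F `` {v}) \<le> 1 \<and> (v \<notin> X \<longrightarrow> (\<exists>q. F `` {v} = {q} \<and> \<not> weak E F q \<and> outside E U q = {})))"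

text \<open>Closes a round: vertices leave the exception set once their outside neighbours are used
  up.\<close>

lemma growing_restrict:
  assumes "growing E U F X" "\<And>x. x \<in> X - Y \<Longrightarrow> outside E U x = {}"
  shows "growing E U F Y"
  using assms unfolding growing_def by blast

lemma attach_Image:
  assumes "tree_on U F" "x \<in> U" "S \<inter> U = {}"
  shows "attach x S F `` {x} = F `` {x} \<union> S"
    and "y \<in> S \<Longrightarrow> attach x S F `` {y} = {x}"
    and "y \<noteq> x \<Longrightarrow> y \<notin> S \<Longrightarrow> attach x S F `` {y} = F `` {y}"
  using assms tree_on_subset[OF assms(1)] by (auto simp: attach_def)

text \<open>A new leaf has a single tree neighbour, and among the old vertices only \<open>x\<close>
  gains any, so only the weakness of \<open>x\<close> has to be examined.\<close>

lemma weak_attach: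
  assumes "tree_on U F" "x \<in> U" "S \<inter> U = {}" "y \<noteq> x"
  shows "weak E (attach x S F) y \<longleftrightarrow> y \<notin> S \<and> weak E F y"
  using attach_Image[OF assms(1-3)] assms(4) by (cases "y \<in> S") (auto simp: weak_def)

text \<open>Only \<open>x\<close> could become weak, and \<open>nw\<close> excludes that, so a weak
  path would be an old one. The new leaves hang from \<open>x\<close>, which is not weak and has no
  outside neighbours left, so they are no exceptions.\<close>

lemma growing_expand_strong:
  assumes G: "growing E U F X" and E: "finite E" "sym E"
    and x: "x \<in> U" and nw: "\<not> weak E (attach x (outside E U x) F) x"
  shows "growing E (U \<union> outside E U x) (attach x (outside E U x) F) X"
proof (cases "outside E U x = {}")
  case True
  then show ?thesis using G by simp
next
  case False
  let ?S = "outside E U x"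
  let ?F = "attach x ?S F"
  have tree: "tree_on U F" and disj: "?S \<inter> U = {}" and fin: "finite ?S"
    using G E by (auto simp: growing_def outside_def)
  note img = attach_Image[OF tree x disj]
  note weak = weak_attach[OF tree x disj]
  have "?F \<subseteq> E"
    using G E by (auto simp: growing_def attach_def outside_def dest: symD)
  moreover have "\<not> (weak E ?F a \<and> weak E ?F b \<and> weak E ?F c)"
    if "(a, b) \<in> ?F" "(b, c) \<in> ?F" "a \<noteq> c" for a b c
  proof
    assume w: "weak E ?F a \<and> weak E ?F b \<and> weak E ?F c"
    then have "a \<noteq> x" "b \<noteq> x" "c \<noteq> x" using nw by auto
    moreover from this have "weak E F a" "weak E F b" "weak E F c"
      using w weak by auto
    ultimately show False
      using that G unfolding growing_def attach_def by auto
  qed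
  moreover have "card (?F `` {v}) \<le> 1 \<and> (v \<notin> X \<longrightarrow> (\<exists>q. ?F `` {v} = {q} \<and> \<not> weak E ?F q \<and>
      outside E (U \<union> ?S) q = {}))"
    if v: "v \<in> U \<union> ?S" "outside E (U \<union> ?S) v \<noteq> {}" for v
  proof (cases "v \<in> ?S")
    case True
    then show ?thesis using img nw by (auto simp: outside_def)
  next
    case False
    with v have "v \<in> U" "v \<noteq> x" "outside E U v \<noteq> {}" by (auto simp: outside_def)
    moreover have "\<not> weak E ?F q" if "\<not> weak E F q" for q
      using that nw weak by metis
    moreover have "outside E (U \<union> ?S) q = {}" if "outside E U q = {}" for q
      using that by (auto simp: outside_def)
    ultimately show ?thesis
      using G img(3)[OF _ False] unfolding growing_def by (metis (no_types, lifting))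
  qed
  ultimately show ?thesis
    using tree_on_attach[OF fin tree x disj] unfolding growing_def by blast
qed

text \<open>Here \<open>x\<close> may become weak. It is not the middle of a weak path, since it had
  at most one tree neighbour before and \<open>w\<close> is a leaf; \<open>sep\<close> excludes weak
  paths that start or end at \<open>x\<close>. The leaf \<open>w\<close> joins the exceptions
  because its neighbour may be weak.\<close>

lemma growing_expand_single:
  assumes G: "growing E U F X" and E: "sym E"
    and x: "x \<in> U" "outside E U x = {w}"
    and sep: "\<And>p q. (x, p) \<in> F \<Longrightarrow> (p, q) \<in> F \<Longrightarrow> q \<noteq> x \<Longrightarrow> \<not> (weak E F p \<and> weak E F q)"
  shows "growing E (insert w U) (attach x {w} F) (insert w X)"
proof -
  let ?F = "attach x {w} F"
  have tree: "tree_on U F" and disj: "{w} \<inter> U = {}" and xw: "(x, w) \<in> E"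
    using G x by (auto simp: growing_def outside_def)
  note img = attach_Image[OF tree x(1) disj]
  note weak = weak_attach[OF tree x(1) disj]
  have symF: "sym F" using tree by (rule tree_on_sym)
  have "x \<noteq> w" using x disj by auto
  have finF: "finite F"
    using tree_on_subset[OF tree] tree_on_finite[OF tree] by (auto intro: finite_subset)
  have "card (F `` {x}) \<le> 1" using G x unfolding growing_def by blast
  then have one: "p = q" if "(x, p) \<in> F" "(x, q) \<in> F" for p q
    using that finF card_le_Suc0_iff_eq[of "F `` {x}"] by auto
  have "?F \<subseteq> E"
    using G E xw by (auto simp: growing_def attach_def dest: symD)
  moreover have "\<not> (weak E ?F a \<and> weak E ?F b \<and> weak E ?F c)"
    if abc: "(a, b) \<in> ?F" "(b, c) \<in> ?F" "a \<noteq> c" for a b c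
  proof
    assume w: "weak E ?F a \<and> weak E ?F b \<and> weak E ?F c"
    then have ne: "a \<noteq> w" "b \<noteq> w" "c \<noteq> w" using weak \<open>x \<noteq> w\<close> by auto
    then have old: "(a, b) \<in> F" "(b, c) \<in> F" using abc by (auto simp: attach_def)
    \<comment> \<open>The cases are the positions of \<open>x\<close> on the path; by symmetry of
      \<open>F\<close>, \<open>x\<close> as last vertex reduces to \<open>x\<close> as
      first.\<close>
    consider "b = x" | "a = x" "b \<noteq> x" "c \<noteq> x" | "c = x" "b \<noteq> x" "a \<noteq> x"
      | "a \<noteq> x" "b \<noteq> x" "c \<noteq> x" using abc(3) by blast
    then show False
    proof cases
      case 1
      then show ?thesis using one[of a c] old symF abc(3) by (auto dest: symD)
    next
      case 2
      then show ?thesis using sep[of b c] old w weak by auto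
    next
      case 3
      then show ?thesis using sep[of b a] old w weak symF by (auto dest: symD)
    next
      case 4
      then have "weak E F a" "weak E F b" "weak E F c" using w weak by auto
      then show ?thesis using G old abc(3) unfolding growing_def by blast
    qed
  qed
  moreover have "card (?F `` {v}) \<le> 1 \<and>
      (v \<notin> insert w X \<longrightarrow> (\<exists>q. ?F `` {v} = {q} \<and> \<not> weak E ?F q \<and>
        outside E (insert w U) q = {}))"
    if v: "v \<in> insert w U" "outside E (insert w U) v \<noteq> {}" for v
  proof (cases "v = w")
    case True
    then show ?thesis using img by simp
  next
    case False
    have "v \<noteq> x" using v x by (auto simp: outside_def)
    with False v have v': "v \<in> U" "outside E U v \<noteq> {}" by (auto simp: outside_def)
    have img_v: "?F `` {v} = F `` {v}" using img(3) \<open>v \<noteq> x\<close> False by simp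
    show ?thesis
    proof (intro conjI impI)
      show "card (?F `` {v}) \<le> 1" using G v' img_v unfolding growing_def by simp
    next
      assume "v \<notin> insert w X"
      then obtain q where q: "F `` {v} = {q}" "\<not> weak E F q" "outside E U q = {}"
        using G v' unfolding growing_def by auto
      \<comment> \<open>\<open>x\<close> has the outside neighbour \<open>w\<close> while
        \<open>q\<close> has none, so the vertex that may become weak is not the one
        \<open>v\<close> hangs from.\<close>
      moreover from this have "q \<noteq> x" using x by auto
      moreover have "outside E (insert w U) q = {}"
        using \<open>outside E U q = {}\<close> by (auto simp: outside_def)
      ultimately show "\<exists>q. ?F `` {v} = {q} \<and> \<not> weak E ?F q \<and> outside E (insert w U) q = {}"
        using img_v weak by auto
    qed
  qed
  ultimately show ?thesis
    using tree_on_attach[OF _ tree x(1) disj] unfolding growing_def by auto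
qed

section \<open>One round of growth\<close>

lemma growing_openD:
  assumes "growing E U F X" "v \<in> U" "outside E U v \<noteq> {}"
  shows "card (F `` {v}) \<le> 1"
    and "v \<notin> X \<Longrightarrow> \<exists>q. F `` {v} = {q} \<and> \<not> weak E F q \<and> outside E U q = {}"
  using assms unfolding growing_def by blast+

lemma growing_tree: "growing E U F X \<Longrightarrow> tree_on U F"
  by (simp add: growing_def)

text \<open>The old neighbour \<open>q\<close> and at least two new ones give \<open>x\<close>
  degree at least 3 in the tree, so it is not weak.\<close>

lemma growing_expand_branching:
  assumes G: "growing E U F X" and E: "finite E" "sym E"
    and x: "x \<in> U" "F `` {x} = {q}" and card: "card (outside E U x) \<ge> 2"
  shows "growing E (U \<union> outside E U x) (attach x (outside E U x) F) X"
proof (rule growing_expand_strong[OF G E x(1)])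
  let ?S = "outside E U x"
  have "?S \<inter> U = {}" by (auto simp: outside_def)
  moreover have "q \<in> U" using x tree_on_subset[OF growing_tree[OF G]] by auto
  ultimately have "q \<notin> ?S" by blast
  moreover have "finite ?S" using E by (auto simp: outside_def)
  moreover have "attach x ?S F `` {x} = insert q ?S"
    using attach_Image(1)[OF growing_tree[OF G] x(1)] x(2) \<open>?S \<inter> U = {}\<close> by simp
  ultimately show "\<not> weak E (attach x ?S F) x" using card by (simp add: weak_def)
qed

text \<open>A leaf that is no exception hangs from a vertex that is not weak, which gives the
  condition \<open>sep\<close> at once.\<close>

lemma growing_expand_leaf:
  assumes G: "growing E U F X" and E: "sym E"
    and x: "x \<in> U" "x \<notin> X" "outside E U x = {w}"
  shows "growing E (insert w U) (attach x {w} F) (insert w X)"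
proof -
  obtain q where "F `` {x} = {q}" "\<not> weak E F q"
    using growing_openD(2)[OF G x(1)] x by auto
  then show ?thesis by (intro growing_expand_single[OF G E x(1,3)]) auto
qed

lemma growing_two_steps:
  assumes G: "growing E U F {}" and E: "finite E" "sym E" "irrefl E"
    and x: "x \<in> U" "outside E U x = {w}" and card: "card (outside E U w) \<noteq> 1"
  shows "\<exists>U' F'. growing E U' F' {} \<and> U \<subset> U'"
proof -
  let ?F = "attach x {w} F"
  have w: "w \<notin> U" using x by (auto simp: outside_def)
  have G1: "growing E (insert w U) ?F {w}"
    using growing_expand_leaf[OF G E(2) x(1) _ x(2)] by simp
  have out: "outside E (insert w U) w = outside E U w"
    using E(3) by (auto simp: outside_def irrefl_def)
  have fin: "finite (outside E U w)" using E by (auto simp: outside_def)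
  show ?thesis
  proof (cases "outside E U w = {}")
    case True
    then have "growing E (insert w U) ?F {}"
      by (intro growing_restrict[OF G1]) (auto simp: out)
    then show ?thesis using w by blast
  next
    case False
    let ?S = "outside E (insert w U) w"
    let ?U = "insert w U \<union> ?S"
    have "card ?S \<noteq> 0" using False fin out by simp
    then have "card ?S \<ge> 2" using card unfolding out by linarith
    moreover have "?F `` {w} = {x}"
      using attach_Image(2)[OF growing_tree[OF G] x(1)] w by simp
    ultimately have "growing E ?U (attach w ?S ?F) {w}"
      by (intro growing_expand_branching[OF G1 E(1,2)]) auto
    then have "growing E ?U (attach w ?S ?F) {}"
      by (rule growing_restrict) (auto simp: outside_def)
    then show ?thesis using w by blast
  qed
qed

lemma growing_progress:
  assumes G: "growing E U F {}" and E: "finite E" "sym E" "irrefl E"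
    and x: "x \<in> U" "outside E U x \<noteq> {}"
  shows "\<exists>U' F'. growing E U' F' {} \<and> U \<subset> U'"
proof (cases "\<exists>v \<in> U. card (outside E U v) \<ge> 2")
  case True
  then obtain v where v: "v \<in> U" "card (outside E U v) \<ge> 2" by blast
  then have ne: "outside E U v \<noteq> {}" by auto
  then obtain q where "F `` {v} = {q}" using growing_openD(2)[OF G v(1)] by auto
  then have "growing E (U \<union> outside E U v) (attach v (outside E U v) F) {}"
    using growing_expand_branching[OF G E(1,2) v(1) _ v(2)] by blast
  moreover have "U \<subset> U \<union> outside E U v" using ne by (auto simp: outside_def)
  ultimately show ?thesis by blast
next
  case False
  \<comment> \<open>From here on no tree vertex has two outside neighbours.\<close>
  have unique: "outside E U v = {y}" if "v \<in> U" "y \<in> outside E U v" for v y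
  proof -
    have "finite (outside E U v)" using E by (auto simp: outside_def)
    moreover have "card (outside E U v) \<le> Suc 0" using False that(1) by force
    ultimately show ?thesis using that(2) card_le_Suc0_iff_eq by blast
  qed
  obtain w where xw: "outside E U x = {w}" using x unique by blast
  have w: "w \<notin> U" "(x, w) \<in> E" using xw by (auto simp: outside_def)
  show ?thesis
  proof (cases "card (outside E U w) = 1")
    case False
    then show ?thesis using growing_two_steps[OF G E x(1) xw] by blast
  next
    case True
    then obtain y where wy: "outside E U w = {y}" by (auto simp: card_1_singleton_iff)
    have y: "y \<notin> U" "(w, y) \<in> E" "y \<noteq> w"
      using wy E(3) by (auto simp: outside_def irrefl_def)
    let ?U1 = "insert w U" and ?F1 = "attach x {w} F"
    have tree: "tree_on U F" using G by (rule growing_tree)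
    have G1: "growing E ?U1 ?F1 {w}"
      using growing_expand_leaf[OF G E(2) x(1) _ xw] by simp
    note img1 = attach_Image[OF tree x(1), of "{w}"]
    show ?thesis
    proof (cases "\<exists>l \<in> U. (l, y) \<in> E")
      case True
      then obtain l where l: "l \<in> U" "outside E U l = {y}"
        using unique y by (auto simp: outside_def)
      show ?thesis
      proof (cases "card (outside E U y) = 1")
        case False
        then show ?thesis using growing_two_steps[OF G E l] by blast
      next
        case True
        \<comment> \<open>\<open>w\<close> and \<open>y\<close> are adjacent and both outside
          \<open>U\<close>, so each is the only outside neighbour of the other; attaching
          \<open>w\<close> to \<open>x\<close> and \<open>y\<close> to \<open>l\<close> leaves
          neither with any.\<close>
        moreover have "w \<in> outside E U y" using y w E(2) by (auto simp: outside_def dest: symD)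
        ultimately have yw: "outside E U y = {w}" by (auto simp: card_1_singleton_iff)
        have "outside E ?U1 l = {y}" using l y by (auto simp: outside_def)
        moreover have "l \<notin> {w}" using l w by auto
        ultimately have "growing E (insert y ?U1) (attach l {y} ?F1) {y, w}"
          using growing_expand_leaf[OF G1 E(2)] l(1) by blast
        then have "growing E (insert y ?U1) (attach l {y} ?F1) {}"
          using wy yw by (rule_tac growing_restrict) (auto simp: outside_def)
        then show ?thesis using w by blast
      qed
    next
      case False
      let ?U2 = "insert y ?U1" and ?F2 = "attach w {y} ?F1"
      obtain q where q: "F `` {x} = {q}" "\<not> weak E F q"
        using growing_openD(2)[OF G x] by auto
      have "q \<noteq> x" using q tree_on_irrefl[OF tree] by auto
      have nw: "\<not> weak E ?F1 q"
        using q(2) weak_attach[OF tree x(1), of "{w}" q] w \<open>q \<noteq> x\<close> by simp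
      have img_x: "?F1 `` {x} = {q, w}" using img1(1) q(1) w by auto
      have img_w: "?F1 `` {w} = {x}" using img1(2) w by simp
      have out_w: "outside E ?U1 w = {y}" using wy y by (auto simp: outside_def)
      \<comment> \<open>A tree path of length 2 from \<open>w\<close> runs through \<open>x\<close>
        to \<open>q\<close>, and \<open>q\<close> stays not weak because it is neither
        \<open>x\<close> nor the new leaf; this yields \<open>sep\<close>.\<close>
      have G2: "growing E ?U2 ?F2 {y, w}"
      proof (rule growing_expand_single[OF G1 E(2) _ out_w])
        show "w \<in> ?U1" by simp
        fix p r assume "(w, p) \<in> ?F1" "(p, r) \<in> ?F1" "r \<noteq> w"
        then have "p = x" "r = q" using img_w img_x by auto
        then show "\<not> (weak E ?F1 p \<and> weak E ?F1 r)" using nw by simp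
      qed
      let ?S = "outside E ?U2 y"
      have img_y: "?F2 `` {y} = {w}"
        using attach_Image(2)[OF growing_tree[OF G1], of w "{y}" y] y by auto
      have "attach y ?S ?F2 `` {y} = {w} \<union> ?S"
        using attach_Image(1)[OF growing_tree[OF G2], of y ?S] img_y by (auto simp: outside_def)
      \<comment> \<open>No vertex of \<open>U\<close> is adjacent to \<open>y\<close>, so its
        neighbours are \<open>w\<close> and the outside ones. Its degrees in the tree and in
        \<open>E\<close> agree, and cannot be both 2 and at least 3.\<close>
      also have "\<dots> = E `` {y}"
        using False y E(2,3) by (auto simp: outside_def irrefl_def dest: symD)
      finally have "\<not> weak E (attach y ?S ?F2) y" by (simp add: weak_def)
      then have "growing E (?U2 \<union> ?S) (attach y ?S ?F2) {y, w}"
        by (intro growing_expand_strong[OF G2 E(1,2)]) auto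
      then have "growing E (?U2 \<union> ?S) (attach y ?S ?F2) {}"
        by (rule growing_restrict) (use wy in \<open>auto simp: outside_def\<close>)
      then show ?thesis using w by blast
    qed
  qed
qed

section \<open>Start and end of the growth\<close>

lemma growing_star:
  assumes "finite E" "sym E" "irrefl E"
  shows "growing E (insert r (E `` {r})) (attach r (E `` {r}) {}) {}"
proof -
  have out: "outside E {r} r = E `` {r}" using assms(3) by (auto simp: outside_def irrefl_def)
  \<comment> \<open>A lone root has no tree neighbour \<open>q\<close> as the invariant asks, so it
    starts as an exception.\<close>
  have "growing E {r} {} {r}" by (auto simp: growing_def tree_on.single)
  \<comment> \<open>All neighbours of \<open>r\<close> are attached at once, so its two degrees
    agree.\<close>
  moreover have "\<not> weak E (attach r (E `` {r}) {}) r"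
    using attach_Image(1)[OF tree_on.single, of r r "E `` {r}"] assms(3)
    by (auto simp: weak_def irrefl_def)
  ultimately have "growing E ({r} \<union> E `` {r}) (attach r (E `` {r}) {}) {r}"
    using growing_expand_strong[of E "{r}" "{}" "{r}" r] assms out by simp
  then have "growing E ({r} \<union> E `` {r}) (attach r (E `` {r}) {}) {}"
    by (rule growing_restrict) (auto simp: outside_def)
  then show ?thesis by simp
qed

text \<open>\<open>growing\<close> names no ambient vertex set. Every tree vertex other than
  \<open>r\<close> is the end of a tree arc, so for \<open>F\<close> inside a finite
  \<open>E\<close> this confines \<open>U\<close> to a finite set.\<close>

lemma tree_on_subset_Field:
  assumes "tree_on U F" "r \<in> U"
  shows "U \<subseteq> insert r (Field F)"
proof
  fix y assume "y \<in> U"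
  with assms have "(r, y) \<in> rtrancl_on U F" by (intro tree_on_reachable)
  then show "y \<in> insert r (Field F)" by cases (auto simp: Field_def)
qed

text \<open>Only finitely many sets \<open>U\<close> are possible, so a maximal one exists;
  \<open>growing_progress\<close> would enlarge it if one of its vertices had an outside
  neighbour.\<close>

lemma growing_saturated:
  assumes E: "finite E" "sym E" "irrefl E"
  shows "\<exists>U F. growing E U F {} \<and> r \<in> U \<and> (\<forall>x \<in> U. E `` {x} \<subseteq> U)"
proof -
  let ?A = "{U. r \<in> U \<and> (\<exists>F. growing E U F {})}"
  have "?A \<subseteq> Pow (insert r (Field E))"
  proof
    fix U assume "U \<in> ?A"
    then obtain F where "r \<in> U" "growing E U F {}" by blast
    then have "tree_on U F" "F \<subseteq> E" by (auto simp: growing_def)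
    then have "U \<subseteq> insert r (Field F)" "Field F \<subseteq> Field E"
      using \<open>r \<in> U\<close> by (simp_all add: tree_on_subset_Field mono_Field monoD)
    then show "U \<in> Pow (insert r (Field E))" by blast
  qed
  moreover have "finite (Pow (insert r (Field E)))"
    using E(1) by (simp add: finite_Field)
  ultimately have "finite ?A" by (rule finite_subset)
  moreover have "?A \<noteq> {}" using growing_star[OF E] by blast
  ultimately have "\<exists>U \<in> ?A. \<forall>U' \<in> ?A. U \<subseteq> U' \<longrightarrow> U = U'" by (rule finite_has_maximal)
  then obtain U where U: "U \<in> ?A" and max: "\<forall>U' \<in> ?A. U \<subseteq> U' \<longrightarrow> U = U'"
    by (elim bexE) (rule that)
  then obtain F where F: "growing E U F {}" "r \<in> U" by blast
  have "outside E U x = {}" if x: "x \<in> U" for x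
  proof (rule ccontr)
    assume "outside E U x \<noteq> {}"
    then obtain U' F' where "growing E U' F' {}" "U \<subset> U'"
      using growing_progress[OF F(1) E x] by blast
    moreover from this have "U' \<in> ?A" using F(2) by blast
    ultimately show False using max by blast
  qed
  then have "\<forall>x \<in> U. E `` {x} \<subseteq> U" by (auto simp: outside_def)
  then show ?thesis using F by blast
qed

section \<open>Transfer to spanning trees of graphs\<close>

lemma degree_eq_card_Image: "degree G v = card (parcs G `` {v})"
proof -
  have "out_arcs (with_proj G) v = Pair v ` (parcs G `` {v})"
    by (auto simp: out_arcs_def)
  then show ?thesis
    by (simp add: degree_def out_degree_def card_image inj_on_def)
qed

theorem theorem3p1:
  fixes G :: "'a pair_pre_digraph"
  assumes "pair_graph G"
    and "connected (with_proj G)"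
  shows "\<exists>T. undirected_spanning_tree T G \<and>
    \<not> (\<exists>u p w. pre_digraph.apath (with_proj T) u p w \<and> length p = 2 \<and>
         (\<forall>x \<in> set (pre_digraph.awalk_verts (with_proj T) u p).
            degree T x = 2 \<and> degree G x \<ge> 3))"
proof -
  interpret G: pair_graph G by fact
  let ?E = "parcs G"
  have E: "finite ?E" "sym ?E" "irrefl ?E"
    using G.pair_finite_arcs G.pair_sym_arcs
    by (auto simp: symmetric_def irrefl_def dest: G.pair_no_loops)
  obtain r where r: "r \<in> pverts G"
    using assms sym_connected_iff by blast
  obtain U F where UF: "growing ?E U F {}" "r \<in> U" "\<forall>x \<in> U. ?E `` {x} \<subseteq> U"
    using growing_saturated[OF E] by blast
  then have tree: "tree_on U F" and sub: "F \<subseteq> ?E"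
    by (auto simp: growing_def)
  have "U \<subseteq> pverts G"
    using tree_on_subset_Field[OF tree UF(2)] sub r
    by (auto simp: Field_def dest: G.in_arcsD1 G.in_arcsD2)
  \<comment> \<open>\<open>U\<close> contains \<open>r\<close> and is closed under adjacency, so
    connectedness of \<open>G\<close> carries it to all vertices.\<close>
  moreover have "y \<in> U" if "y \<in> pverts G" for y
  proof -
    have "(r, y) \<in> rtrancl_on (pverts G) ?E"
      using assms r that sym_connected_iff by blast
    then show ?thesis by (induction rule: rtrancl_on_induct) (use UF in auto)
  qed
  ultimately have U: "U = pverts G" by blast
  let ?T = "\<lparr>pverts = U, parcs = F\<rparr>"
  interpret T: pair_graph ?T using tree by (rule tree_on_pair_graph)
  have "spanning (with_proj ?T) (with_proj G)"
    using U sub G.wf_digraph T.wf_digraph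
    by (auto simp: spanning_def subgraph_def compatible_def)
  then have "undirected_spanning_tree ?T G"
    using tree_on_undirected_tree[OF tree] by (simp add: undirected_spanning_tree_def)
  moreover have False
    if path: "pre_digraph.apath (with_proj ?T) u p w" "length p = 2"
      and weak: "\<And>x. x \<in> set (pre_digraph.awalk_verts (with_proj ?T) u p) \<Longrightarrow>
        degree ?T x = 2 \<and> degree G x \<ge> 3" for u p w
  proof -
    obtain d e where p: "p = [d, e]"
      using path(2) by (auto simp: length_Suc_conv numeral_2_eq_2)
    \<comment> \<open>The three vertices are \<open>fst d\<close>, \<open>snd d\<close> and
      \<open>snd e\<close>; an \<open>apath\<close> repeats no vertex, so its ends differ, as the
      invariant requires.\<close>
    have "(fst d, snd d) \<in> F" "(snd d, snd e) \<in> F" "fst d \<noteq> snd e"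
      using path(1) unfolding p
      by (auto simp: pre_digraph.apath_def pre_digraph.awalk_def cas_with_proj_eq
          awalk_verts_with_proj_eq) (metis prod.collapse)
    moreover have "weak ?E F (fst d)" "weak ?E F (snd d)" "weak ?E F (snd e)"
      using weak path(1) unfolding p
      by (auto simp: weak_def degree_eq_card_Image awalk_verts_with_proj_eq
          pre_digraph.apath_def pre_digraph.awalk_def cas_with_proj_eq)
    ultimately show False using UF(1) unfolding growing_def by blast
  qed
  ultimately show ?thesis by blast
qed

end
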